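(* Let $H=\{a,b\}$ be a two-heap multiset of positive integers with $0<a\le b$, and let $G=G(\textsc{hats-nim},H)$ be the associated game graph. The metric dimension of $G$ is $$\beta(G)=\begin{cases} 1 & \text{when } a=b \text{ or } H=\{1,2\},\\ 2 & \text{when } 2<b=a+1, \text{ or } a=1 \text{ and } b>2,\\ 3 & \text{otherwise.}\end{cases}$$
   Context: Hats-Nim ("Heaps Are The Subtraction sets"): a position is a finite multiset of positive integers (the sizes of the nonempty heaps); the empty multiset is the terminal position $0$. From a position $P$, a move consists of choosing a heap $h\in P$ and an element $s\in P$ with $s\le h$ (possibly $s$ is the size of the same heap), and replacing $h$ by $h-s$; a heap that becomes $0$ is deleted. The subtraction set is thus the set of heap sizes in the current position. The game graph $G(\textsc{hats-nim},H)$ is the digraph whose vertices are all positions reachable from $H$ (including $H$ itself), with an arc from a position $p$ to a position $q$ whenever there is a legal move from $p$ to $q$ (each position, as a multiset, appears as one vertex). Signed distance: in a digraph, let $d(u,v)$ be the number of arcs in a shortest directed path from $u$ to $v$ ($\infty$ if there is none, $d(u,u)=0$). The signed distance is $$d_{\pm}(u,v)=\begin{cases} d(u,v) & \text{if there is a directed } uv\text{-path and } d(u,v)\le d(v,u),\\ -d(v,u) & \text{if there is a directed } vu\text{-path and } d(v,u)<d(u,v),\\ \infty & \text{if there is neither a directed } uv\text{-path nor a directed } vu\text{-path.}\end{cases}$$ Metric dimension: for an ordered set $S=(u_1,\dots,u_k)$ of vertices, the distance vector of a vertex $v$ is $(d_\pm(u_1,v),\dots,d_\pm(u_k,v))$.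 $S$ is a resolving set if distinct vertices of the graph have distinct distance vectors. The metric dimension $\beta(G)$ is the minimum cardinality of a resolving set.
   Formalization: As stated the formula fails when gcd(a,b)>1 (for H={2,4} it gives 3, but β=1); the conditions H={1,2}, 2<b=a+1, and a=1 with b>2 are imposed on a/gcd(a,b) and b/gcd(a,b) instead of a and b; all pairs 0<a≤b remain covered. *)

theory Defs
  imports
    "HOL-Library.Multiset"
    "HOL-Library.Extended_Nat"
    "Graph_Theory.Graph_Theory"
begin

context wf_digraph
begin

definition arc_dist :: "'a \<Rightarrow> 'a \<Rightarrow> ereal" where
  "arc_dist u v = \<mu> (\<lambda>_. 1) u v"

definition signed_dist :: "'a \<Rightarrow> 'a \<Rightarrow> ereal" where
  "signed_dist u v =
    (if u \<rightarrow>\<^sup>* v \<and> arc_dist u v \<le> arc_dist v u then arc_dist u v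
     else if v \<rightarrow>\<^sup>* u \<and> arc_dist v u < arc_dist u v then - arc_dist v u
     else \<infinity>)"

definition dist_vector :: "'a list \<Rightarrow> 'a \<Rightarrow> ereal list" where
  "dist_vector us v = map (\<lambda>u. signed_dist u v) us"

text \<open>Ordered sets of vertices are distinct lists.\<close>

definition resolving :: "'a list \<Rightarrow> bool" where
  "resolving us \<longleftrightarrow>
    distinct us \<and> set us \<subseteq> verts G \<and> inj_on (dist_vector us) (verts G)"

text \<open>The infimum is attained as soon as some finite resolving set exists, which is always
  the case in a finite digraph; otherwise the value is \<open>\<infinity>\<close>.\<close>

definition metric_dimension :: enat where
  "metric_dimension = (INF us\<in>{us. resolving us}. enat (length us))"

end

definition hats_nim_move :: "nat multiset \<Rightarrow> nat multiset \<Rightarrow> bool" where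
  "hats_nim_move P Q \<longleftrightarrow>
    (\<exists>h s. h \<in># P \<and> s \<in># P \<and> s \<le> h \<and>
      Q = (P - {#h#}) + (if s = h then {#} else {#h - s#}))"

definition hats_nim_graph :: "nat multiset \<Rightarrow> nat multiset pair_pre_digraph" where
  "hats_nim_graph H =
    \<lparr> pverts = {P. hats_nim_move\<^sup>*\<^sup>* H P},
      parcs = {(P, Q). hats_nim_move\<^sup>*\<^sup>* H P \<and> hats_nim_move P Q} \<rparr>"

lemma wf_digraph_hats_nim_graph: "wf_digraph (with_proj (hats_nim_graph H))"
  by unfold_locales (auto simp: hats_nim_graph_def intro: rtranclp.rtrancl_into_rtrancl)

end

(*
The pairs reachable from {a, b} form the chain P 0, ..., P m of the subtractive Euclidean algorithm,
ending in {g, g} with g = gcd a b. Besides them there are only the single heaps {v}, with v occurring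
in some pair, and the empty position; {v} is reached from P i as soon as v occurs in the current pair.

Upper bounds: P m resolves if m <= 1; P i and {g} resolve if g occurs in P i for some i <= 1;
P 0, the empty position and {b} always resolve.

Lower bounds: let z be the value that enters the chain with P (m - 1). Only the empty position,
P m, {z} and {g} have different distances to P m and {z}, so every resolving set contains one of
these four. If g occurs neither in P 0 nor in P 1, none of the four distinguishes any two of {a},
{b}, {b - a}, while no single further landmark separates all three.
*)
theory Submission
  imports Defs
begin

section \<open>Signed distances from powers of the arc relation\<close>

context wf_digraph
begin

lemma awalk_imp_relpow: "awalk u p v \<Longrightarrow> (u, v) \<in> arcs_ends G ^^ length p"
proof (induction p arbitrary: u)
  case (Cons e p)
  then have "(u, head G e) \<in> arcs_ends G" "awalk (head G e) p v"
    by (auto simp: awalk_Cons_iff arcs_ends_conv)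
  then show ?case
    using relpow_Suc_I2[OF _ Cons.IH] by simp
qed (simp add: awalk_Nil_iff)

text \<open>The start has to be a vertex because of \<open>n = 0\<close>: the zeroth power relates
  every point to itself, whereas the empty walk exists only at a vertex.\<close>

lemma relpow_imp_awalk:
  assumes "(u, v) \<in> arcs_ends G ^^ n" "u \<in> verts G"
  obtains p where "awalk u p v" "length p = n"
  using assms
proof (induction n arbitrary: u thesis)
  case 0
  then show ?case
    by (auto simp: awalk_Nil_iff)
next
  case (Suc n)
  obtain w where w: "(u, w) \<in> arcs_ends G" "(w, v) \<in> arcs_ends G ^^ n"
    using Suc.prems(2) by (blast elim: relpow_Suc_E2)
  then obtain e where e: "e \<in> arcs G" "tail G e = u" "head G e = w"
    by (auto simp: arcs_ends_conv)
  then have "w \<in> verts G" by auto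
  then obtain p where "awalk w p v" "length p = n"
    using Suc.IH w by blast
  then show ?case
    using e Suc.prems(1)[of "e # p"] by (auto simp: awalk_Cons_iff)
qed

lemma awalk_cost_one: "awalk_cost (\<lambda>_. 1) p = real (length p)"
  by (induction p) auto

text \<open>Walks of length \<open>k\<close> from a vertex correspond to membership in the
  \<open>k\<close>-th power, so the infimum over walks is attained at the least such exponent. Moves
  can then be counted by induction, without naming walks.\<close>

lemma arc_dist_eqI:
  assumes "u \<in> verts G" "(u, v) \<in> arcs_ends G ^^ n"
    and least: "\<And>k. k < n \<Longrightarrow> (u, v) \<notin> arcs_ends G ^^ k"
  shows "arc_dist u v = ereal (real n)"
  unfolding arc_dist_def
proof (rule antisym)
  show "\<mu> (\<lambda>_. 1) u v \<le> ereal (real n)"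
    by (metis relpow_imp_awalk[OF assms(2,1)] min_cost_le_walk_cost awalk_cost_one)
  show "ereal (real n) \<le> \<mu> (\<lambda>_. 1) u v"
    unfolding \<mu>_def awalk_cost_one
  proof (rule INF_greatest)
    fix p
    assume "p \<in> {p. awalk u p v}"
    then have "\<not> length p < n"
      using awalk_imp_relpow least by blast
    then show "ereal (real n) \<le> ereal (real (length p))" by simp
  qed
qed

lemma not_reachable_relpow:
  "(\<And>k. (u, v) \<notin> arcs_ends G ^^ k) \<Longrightarrow> \<not> u \<rightarrow>\<^sup>* v"
  using awalk_imp_relpow reachable_awalk by blast

lemma relpow_reachable: "u \<in> verts G \<Longrightarrow> (u, v) \<in> arcs_ends G ^^ n \<Longrightarrow> u \<rightarrow>\<^sup>* v"
  by (metis relpow_imp_awalk reachable_awalk)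

lemma arc_dist_infinity: "\<not> u \<rightarrow>\<^sup>* v \<Longrightarrow> arc_dist u v = \<infinity>"
  unfolding arc_dist_def by (rule shortest_path_inf)

lemma signed_dist_self: "u \<in> verts G \<Longrightarrow> signed_dist u u = 0"
  using arc_dist_eqI[of u u 0] by (simp add: signed_dist_def)

text \<open>Every move of the game lowers the total heap size, so two distinct positions are joined
  by paths in at most one direction. Hence this lemma and the next two never have to compare two
  finite distances.\<close>

lemma signed_dist_forward:
  assumes "u \<in> verts G" "(u, v) \<in> arcs_ends G ^^ n"
    "\<And>k. k < n \<Longrightarrow> (u, v) \<notin> arcs_ends G ^^ k" "\<And>k. (v, u) \<notin> arcs_ends G ^^ k"
  shows "signed_dist u v = ereal (real n)"
  using arc_dist_eqI[OF assms(1-3)] relpow_reachable[OF assms(1,2)]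
    arc_dist_infinity[OF not_reachable_relpow[OF assms(4)]]
  by (auto simp: signed_dist_def)

lemma signed_dist_backward:
  assumes "v \<in> verts G" "(v, u) \<in> arcs_ends G ^^ n"
    "\<And>k. k < n \<Longrightarrow> (v, u) \<notin> arcs_ends G ^^ k" "\<And>k. (u, v) \<notin> arcs_ends G ^^ k"
  shows "signed_dist u v = ereal (- real n)"
  using arc_dist_eqI[OF assms(1-3)] relpow_reachable[OF assms(1,2)]
    arc_dist_infinity[OF not_reachable_relpow[OF assms(4)]] not_reachable_relpow[OF assms(4)]
  by (auto simp: signed_dist_def)

lemma signed_dist_infinity:
  assumes "\<And>k. (u, v) \<notin> arcs_ends G ^^ k" "\<And>k. (v, u) \<notin> arcs_ends G ^^ k"
  shows "signed_dist u v = \<infinity>"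
  using assms not_reachable_relpow by (simp add: signed_dist_def)

lemma resolving_iff:
  "resolving us \<longleftrightarrow> distinct us \<and> set us \<subseteq> verts G \<and>
    (\<forall>p\<in>verts G. \<forall>q\<in>verts G. (\<forall>u\<in>set us. signed_dist u p = signed_dist u q) \<longrightarrow> p = q)"
  by (auto simp: resolving_def inj_on_def dist_vector_def)

lemma metric_dimension_eqI:
  assumes "resolving us" "length us = n" "\<And>vs. resolving vs \<Longrightarrow> n \<le> length vs"
  shows "metric_dimension = enat n"
  unfolding metric_dimension_def
  using assms by (intro antisym INF_greatest INF_lower2[of us]) auto

end

section \<open>The chain of pairs of the subtractive Euclidean algorithm\<close>

text \<open>Which of \<open>x i\<close> and \<open>y i - x i\<close> is the smaller heap varies with
  \<open>i\<close>, so \<open>step\<close> equates multisets, while \<open>lt\<close> and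
  \<open>last\<close> fix the order inside a pair and make \<open>m\<close> the first index with
  equal heaps.\<close>

locale subtractive_chain =
  fixes x y :: "nat \<Rightarrow> nat" and m :: nat
  assumes pos: "i \<le> m \<Longrightarrow> 0 < x i"
    and lt: "i < m \<Longrightarrow> x i < y i"
    and last: "x m = y m"
    and step: "i < m \<Longrightarrow> {#x (Suc i), y (Suc i)#} = {#x i, y i - x i#}"
begin

definition E :: "nat \<Rightarrow> nat set" where
  "E i = {x i, y i}"

definition V :: "nat set" where
  "V = (\<Union>i\<le>m. E i)"

abbreviation P :: "nat \<Rightarrow> nat multiset" where
  "P i \<equiv> {#x i, y i#}"

abbreviation G :: "(nat multiset, nat multiset \<times> nat multiset) pre_digraph" where
  "G \<equiv> with_proj (hats_nim_graph (P 0))"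

lemma le: "i \<le> m \<Longrightarrow> x i \<le> y i"
  using lt last by (cases "i = m") (auto simp: less_imp_le)

lemma E_Suc: "i < m \<Longrightarrow> E (Suc i) = {x i, y i - x i}"
  using arg_cong[OF step, of i set_mset] by (simp add: E_def)

lemma y_less:
  assumes "i < j" "j \<le> m"
  shows "y j < y i"
proof -
  have "y (Suc k) < y k" if "k < m" for k
  proof -
    have "y (Suc k) \<in> {x k, y k - x k}"
      using E_Suc[OF that] by (auto simp: E_def)
    then show ?thesis
      using lt[OF that] pos[of k] that by auto
  qed
  then show ?thesis
    using assms
  proof (induction j)
    case (Suc j)
    then show ?case
      by (cases "i = j") (simp, metis Suc_leD Suc_le_lessD less_SucE less_trans)
  qed simp
qed

lemma E_le: "v \<in> E i \<Longrightarrow> i \<le> m \<Longrightarrow> v \<le> y i"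
  using le by (auto simp: E_def)

text \<open>The only value that a step can discard is the larger heap \<open>y j\<close>, and all
  later heaps are smaller than that; so a value that has left the chain never returns.\<close>

lemma E_interval:
  assumes "i \<le> j" "j \<le> k" "k \<le> m" "v \<in> E i" "v \<in> E k"
  shows "v \<in> E j"
  using assms(1,2)
proof (induction j rule: dec_induct)
  case (step j)
  then have j: "j < m" "v \<in> E j"
    using assms(3) by auto
  then have "v = y j" if "v \<notin> E (Suc j)"
    using E_Suc[of j] that by (auto simp: E_def)
  moreover have "v < y j"
    using E_le[OF assms(5,3)] y_less[of j k] step.prems assms(3) by auto
  ultimately show ?case by auto
qed (use assms in auto)

lemma y_notin_E: "i < j \<Longrightarrow> j \<le> m \<Longrightarrow> y i \<notin> E j"
  using E_le[of "y i" j] y_less[of i j] by auto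

lemma fresh_in_E: "i < m \<Longrightarrow> y i - x i \<in> E (Suc i)"
  using E_Suc by auto

text \<open>An earlier occurrence would persist up to \<open>E i\<close> and force
  \<open>y i - x i = x i\<close>. Then \<open>P (Suc i)\<close> would have equal heaps and be the
  last pair, against \<open>Suc i < m\<close>.\<close>

lemma fresh_notin_E:
  assumes "j \<le> i" "Suc i < m"
  shows "y i - x i \<notin> E j"
proof
  assume "y i - x i \<in> E j"
  then have "y i - x i \<in> E i"
    using E_interval[of j i "Suc i"] fresh_in_E[of i] assms by auto
  then have "y i - x i = x i"
    using pos[of i] lt[of i] assms by (auto simp: E_def)
  then have "E (Suc i) = {x i}"
    using E_Suc[of i] assms by auto
  then show False
    using lt[of "Suc i"] assms by (auto simp: E_def)
qed

lemma fresh_unique: "i < m \<Longrightarrow> v \<in> E (Suc i) \<Longrightarrow> v \<notin> E i \<Longrightarrow> v = y i - x i"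
  using E_Suc by (auto simp: E_def)

lemma P_eq_iff: "i \<le> m \<Longrightarrow> j \<le> m \<Longrightarrow> P i = P j \<longleftrightarrow> i = j"
proof -
  assume "i \<le> m" "j \<le> m"
  moreover have "E i = E j" if "P i = P j"
    using arg_cong[OF that, of set_mset] by (simp add: E_def)
  moreover have "y k \<in> E k" for k
    by (simp add: E_def)
  ultimately show ?thesis
    using y_notin_E[of i j] y_notin_E[of j i] by (cases i j rule: linorder_cases) auto
qed

section \<open>Moves and plays of the game\<close>

lemma move_P:
  assumes "i \<le> m"
  shows "hats_nim_move (P i) Q \<longleftrightarrow> (i < m \<and> Q = P (Suc i)) \<or> (\<exists>v\<in>E i. Q = {#v#})"
proof (cases "i = m")
  case True
  then show ?thesis
    using last by (auto simp: hats_nim_move_def E_def)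
next
  case False
  then have i: "i < m" using assms by simp
  show ?thesis
  proof
    assume "hats_nim_move (P i) Q"
    then show "(i < m \<and> Q = P (Suc i)) \<or> (\<exists>v\<in>E i. Q = {#v#})"
      using lt[OF i] unfolding step[OF i] hats_nim_move_def E_def
      by (auto simp: i add_mset_commute)
  next
    assume "(i < m \<and> Q = P (Suc i)) \<or> (\<exists>v\<in>E i. Q = {#v#})"
    then consider "Q = P (Suc i)" | "Q = {#y i#}" | "Q = {#x i#}"
      by (auto simp: E_def)
    then have "\<exists>h\<in>E i. \<exists>s\<in>E i. s \<le> h \<and>
        Q = (P i - {#h#}) + (if s = h then {#} else {#h - s#})"
    proof cases
      case 1
      then show ?thesis
        using lt[OF i] unfolding step[OF i]
        by (intro bexI[of _ "y i"] bexI[of _ "x i"]) (auto simp: E_def add_mset_commute)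
    next
      case 2
      then show ?thesis
        by (intro bexI[of _ "x i"]) (auto simp: E_def)
    next
      case 3
      then show ?thesis
        by (intro bexI[of _ "y i"]) (auto simp: E_def)
    qed
    moreover have "h \<in># P i \<longleftrightarrow> h \<in> E i" for h
      by (auto simp: E_def)
    ultimately show "hats_nim_move (P i) Q"
      unfolding hats_nim_move_def by blast
  qed
qed

lemma move_single: "hats_nim_move {#v#} Q \<longleftrightarrow> Q = {#}"
  by (auto simp: hats_nim_move_def)

lemma move_empty: "\<not> hats_nim_move {#} Q"
  by (auto simp: hats_nim_move_def)

text \<open>A play follows the chain for a while, drops to one heap of the current pair and then to
  the empty position. In the last two alternatives \<open>k\<close> counts the moves along the
  chain.\<close>

lemma relpowp_P:
  assumes "i \<le> m"
  shows "(hats_nim_move ^^ n) (P i) Q \<longleftrightarrow> (i + n \<le> m \<and> Q = P (i + n)) \<or>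
    (\<exists>k. n = Suc k \<and> i + k \<le> m \<and> (\<exists>v\<in>E (i + k). Q = {#v#})) \<or>
    (\<exists>k. n = k + 2 \<and> i + k \<le> m \<and> Q = {#})"
proof (induction n arbitrary: Q)
  case 0
  then show ?case using assms by auto
next
  case (Suc n)
  show ?case (is "_ \<longleftrightarrow> ?R")
  proof
    assume "(hats_nim_move ^^ Suc n) (P i) Q"
    then obtain W where W: "(hats_nim_move ^^ n) (P i) W" "hats_nim_move W Q"
      by auto
    then consider "i + n \<le> m" "W = P (i + n)"
      | k v where "n = Suc k" "i + k \<le> m" "W = {#v#}" | "W = {#}"
      using Suc.IH[of W] by blast
    then show ?R
    proof cases
      case 1
      then show ?thesis
        using W(2) move_P[of "i + n" Q] by auto
    next
      case 2
      then show ?thesis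
        using W(2) move_single by auto
    next
      case 3
      then show ?thesis
        using W(2) move_empty by auto
    qed
  next
    assume ?R
    then consider "i + n < m" "Q = P (Suc (i + n))" | v where "i + n \<le> m" "v \<in> E (i + n)" "Q = {#v#}"
      | k where "n = Suc k" "i + k \<le> m" "Q = {#}"
      by auto
    then show "(hats_nim_move ^^ Suc n) (P i) Q"
    proof cases
      case 1
      then have "(hats_nim_move ^^ n) (P i) (P (i + n))" "hats_nim_move (P (i + n)) Q"
        using Suc.IH[of "P (i + n)"] move_P[of "i + n" Q] by auto
      then show ?thesis by auto
    next
      case 2
      then have "(hats_nim_move ^^ n) (P i) (P (i + n))" "hats_nim_move (P (i + n)) Q"
        using Suc.IH[of "P (i + n)"] move_P[of "i + n" Q] by auto
      then show ?thesis by auto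
    next
      case 3
      \<comment> \<open>Either heap of \<open>P (i + k)\<close> could be the one left before the
        final move; \<open>x (i + k)\<close> is taken.\<close>
      then have "(hats_nim_move ^^ n) (P i) {#x (i + k)#}" "hats_nim_move {#x (i + k)#} Q"
        using Suc.IH[of "{#x (i + k)#}"] move_single[of "x (i + k)" Q] by (auto simp: E_def)
      then show ?thesis by auto
    qed
  qed
qed

lemma relpowp_single:
  "(hats_nim_move ^^ n) {#v#} Q \<longleftrightarrow> (n = 0 \<and> Q = {#v#}) \<or> (n = 1 \<and> Q = {#})"
proof -
  consider "n = 0" | "n = 1" | k where "n = Suc (Suc k)"
    by (metis One_nat_def not0_implies_Suc)
  then show ?thesis
    by cases (auto simp: move_single move_empty relpowp_Suc_right relcompp_apply
        simp del: relpowp.simps(2) dest!: relpowp_Suc_D2)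
qed

lemma relpowp_empty: "(hats_nim_move ^^ n) {#} Q \<longleftrightarrow> n = 0 \<and> Q = {#}"
  by (cases n) (auto simp: move_empty simp del: relpowp.simps(2) dest!: relpowp_Suc_D2)

lemma verts_G: "verts G = P ` {..m} \<union> (\<lambda>v. {#v#}) ` V \<union> {{#}}"
proof (intro set_eqI)
  fix Q
  have "Q \<in> verts G \<longleftrightarrow> (\<exists>n. (hats_nim_move ^^ n) (P 0) Q)"
    by (simp add: hats_nim_graph_def rtranclp_power)
  then show "Q \<in> verts G \<longleftrightarrow> Q \<in> P ` {..m} \<union> (\<lambda>v. {#v#}) ` V \<union> {{#}}"
    unfolding relpowp_P[of 0, simplified] V_def by auto
qed

sublocale wf_digraph G
  by (rule wf_digraph_hats_nim_graph)

text \<open>Arcs are the moves that start at a reachable position, and reachable positions are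
  closed under moves, so a play from a vertex never leaves the graph.\<close>

lemma relpow_arcs_ends:
  assumes "p \<in> verts G"
  shows "(p, q) \<in> arcs_ends G ^^ n \<longleftrightarrow> (hats_nim_move ^^ n) p q"
proof (induction n arbitrary: q)
  case (Suc n)
  have "w \<in> verts G" if "(hats_nim_move ^^ n) p w" for w
    using that assms by (auto simp: hats_nim_graph_def dest!: relpowp_imp_rtranclp)
  then have "(w, q) \<in> arcs_ends G \<longleftrightarrow> hats_nim_move w q" if "(hats_nim_move ^^ n) p w" for w
    using that by (auto simp: hats_nim_graph_def)
  then show ?case
    using Suc.IH by (auto simp: relcomp_unfold relcompp_apply)
qed auto

lemma relpowp_P_P:
  "i \<le> m \<Longrightarrow> k \<le> m \<Longrightarrow> (hats_nim_move ^^ n) (P i) (P k) \<longleftrightarrow> k = i + n"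
  using P_eq_iff[of k "i + n"] by (auto simp: relpowp_P)

lemma relpowp_P_single:
  "i \<le> m \<Longrightarrow> (hats_nim_move ^^ n) (P i) {#v#} \<longleftrightarrow>
    (\<exists>k. n = Suc k \<and> i + k \<le> m \<and> v \<in> E (i + k))"
  by (auto simp: relpowp_P)

lemma relpowp_P_empty:
  "i \<le> m \<Longrightarrow> (hats_nim_move ^^ n) (P i) {#} \<longleftrightarrow> (\<exists>k. n = k + 2 \<and> i + k \<le> m)"
  by (auto simp: relpowp_P)

lemma P_vert: "i \<le> m \<Longrightarrow> P i \<in> verts G"
  and single_vert: "v \<in> V \<Longrightarrow> {#v#} \<in> verts G"
  and empty_vert: "{#} \<in> verts G"
  unfolding verts_G by blast+

lemma E_subset_V: "i \<le> m \<Longrightarrow> E i \<subseteq> V"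
  by (auto simp: V_def)

lemma fresh_in_V: "i < m \<Longrightarrow> y i - x i \<in> V"
  using fresh_in_E[of i] E_subset_V[of "Suc i"] by auto

lemma vert_cases:
  assumes "p \<in> verts G"
  obtains (P) i where "i \<le> m" "p = P i" | (single) v where "v \<in> V" "p = {#v#}" | (empty) "p = {#}"
  using assms unfolding verts_G by blast

lemmas relpow_simps = relpow_arcs_ends[OF P_vert] relpow_arcs_ends[OF single_vert]
  relpow_arcs_ends[OF empty_vert] relpowp_P_P relpowp_P_single relpowp_P_empty
  relpowp_single relpowp_empty

section \<open>Signed distances between positions\<close>

lemma signed_dist_P_P:
  assumes "i \<le> m" "k \<le> m"
  shows "signed_dist (P i) (P k) = ereal (real k - real i)"
proof (cases i k rule: linorder_cases)
  case less
  then show ?thesis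
    using assms signed_dist_forward[OF P_vert, of i "P k" "k - i"]
    by (auto simp: relpow_simps of_nat_diff simp del: with_proj_simps relpow.simps relpowp.simps)
next
  case equal
  then show ?thesis
    using assms signed_dist_self[OF P_vert, of i] by (simp add: zero_ereal_def)
next
  case greater
  then show ?thesis
    using assms signed_dist_backward[OF P_vert, of k "P i" "i - k"]
    by (auto simp: relpow_simps of_nat_diff simp del: with_proj_simps relpow.simps relpowp.simps)
qed

text \<open>The shortest play walks along the chain to the first pair containing \<open>v\<close>
  and spends one more move on removing the other heap.\<close>

lemma signed_dist_P_single:
  assumes "i + n \<le> m" "v \<in> E (i + n)" "\<And>l. l < n \<Longrightarrow> v \<notin> E (i + l)"
  shows "signed_dist (P i) {#v#} = ereal (real (Suc n))"
    and "signed_dist {#v#} (P i) = ereal (- real (Suc n))"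
proof -
  have v: "v \<in> V" and i: "i \<le> m"
    using assms(1,2) E_subset_V by auto
  show "signed_dist (P i) {#v#} = ereal (real (Suc n))"
    using v i assms by (intro signed_dist_forward)
      (auto simp: relpow_simps simp del: with_proj_simps relpow.simps relpowp.simps intro: P_vert)
  show "signed_dist {#v#} (P i) = ereal (- real (Suc n))"
    using v i assms by (intro signed_dist_backward)
      (auto simp: relpow_simps simp del: with_proj_simps relpow.simps relpowp.simps intro: P_vert)
qed

lemma signed_dist_P_single_infinity:
  assumes "i \<le> m" "v \<in> V" "\<And>k. i \<le> k \<Longrightarrow> k \<le> m \<Longrightarrow> v \<notin> E k"
  shows "signed_dist (P i) {#v#} = \<infinity>" "signed_dist {#v#} (P i) = \<infinity>"
  using assms by (auto intro!: signed_dist_infinity simp: relpow_simps simp del: with_proj_simps relpow.simps relpowp.simps)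

text \<open>Removing one whole heap in each of two moves always suffices, and a single move never
  does. Hence the empty position cannot tell two pairs apart.\<close>

lemma signed_dist_P_empty:
  assumes "i \<le> m"
  shows "signed_dist (P i) {#} = 2" "signed_dist {#} (P i) = -2"
proof -
  have "signed_dist (P i) {#} = ereal (real 2)"
    using assms by (intro signed_dist_forward)
      (auto simp: relpow_simps simp del: with_proj_simps relpow.simps relpowp.simps intro: P_vert)
  then show "signed_dist (P i) {#} = 2" by simp
  have "signed_dist {#} (P i) = ereal (- real 2)"
    using assms by (intro signed_dist_backward)
      (auto simp: relpow_simps simp del: with_proj_simps relpow.simps relpowp.simps intro: P_vert)
  then show "signed_dist {#} (P i) = -2" by simp
qed

lemma signed_dist_single_single:
  assumes "v \<in> V" "w \<in> V"
  shows "signed_dist {#v#} {#w#} = (if v = w then 0 else \<infinity>)"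
  using assms signed_dist_self[OF single_vert]
  by (auto intro!: signed_dist_infinity simp: relpow_simps simp del: with_proj_simps relpow.simps relpowp.simps)

lemma signed_dist_single_empty:
  assumes "v \<in> V"
  shows "signed_dist {#v#} {#} = 1" "signed_dist {#} {#v#} = -1"
proof -
  have "signed_dist {#v#} {#} = ereal (real 1)"
    using assms by (intro signed_dist_forward)
      (auto simp: relpow_simps move_single simp del: with_proj_simps relpow.simps relpowp.simps
        intro: single_vert)
  then show "signed_dist {#v#} {#} = 1" by simp
  have "signed_dist {#} {#v#} = ereal (- real 1)"
    using assms by (intro signed_dist_backward)
      (auto simp: relpow_simps move_single simp del: with_proj_simps relpow.simps relpowp.simps
        intro: single_vert)
  then show "signed_dist {#} {#v#} = -1" by (simp add: one_ereal_def)
qed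

lemma signed_dist_empty_empty: "signed_dist {#} {#} = 0"
  using signed_dist_self[OF empty_vert] .

lemma signed_dist_P_single_one:
  "i \<le> m \<Longrightarrow> v \<in> E i \<Longrightarrow> signed_dist (P i) {#v#} = 1"
  using signed_dist_P_single(1)[of i 0 v] by simp

lemma first_occurrence:
  assumes "v \<in> E k" "i \<le> k" "k \<le> m"
  obtains n where "i + n \<le> m" "v \<in> E (i + n)" "\<And>l. l < n \<Longrightarrow> v \<notin> E (i + l)"
proof -
  define n where "n = (LEAST n. v \<in> E (i + n))"
  have "v \<in> E (i + (k - i))"
    using assms by simp
  then have "v \<in> E (i + n)" "n \<le> k - i"
    unfolding n_def by (fact LeastI, fact Least_le)
  moreover have "v \<notin> E (i + l)" if "l < n" for l
    using not_less_Least that unfolding n_def by blast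
  ultimately show ?thesis
    using that[of n] assms by simp
qed

lemma signed_dist_P_single_cases:
  assumes "i \<le> m" "v \<in> V"
  obtains (now) "v \<in> E i" "signed_dist (P i) {#v#} = 1"
  | (later) n where "i + n < m" "v = y (i + n) - x (i + n)" "v \<notin> E i"
      "signed_dist (P i) {#v#} = ereal (real (n + 2))"
  | (never) "\<And>k. i \<le> k \<Longrightarrow> k \<le> m \<Longrightarrow> v \<notin> E k" "signed_dist (P i) {#v#} = \<infinity>"
proof (cases "\<exists>k. i \<le> k \<and> k \<le> m \<and> v \<in> E k")
  case True
  then obtain n where n: "i + n \<le> m" "v \<in> E (i + n)" "\<And>l. l < n \<Longrightarrow> v \<notin> E (i + l)"
    using first_occurrence by metis
  show ?thesis
  proof (cases n)
    case 0
    then show ?thesis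
      using now n assms signed_dist_P_single_one by auto
  next
    \<comment> \<open>Being absent from \<open>E (i + l)\<close>, the value is the one that enters
      in the step to \<open>E (i + n)\<close>; so \<open>n = l + 1\<close> chain moves and one drop
      give distance \<open>l + 2\<close>.\<close>
    case (Suc l)
    then have "v = y (i + l) - x (i + l)" "v \<notin> E i"
      using n(3)[of l] n(3)[of 0] n(1,2) fresh_unique[of "i + l" v] by auto
    then show ?thesis
      using later[of l] n Suc signed_dist_P_single(1)[OF n] by simp
  qed
next
  case False
  then show ?thesis
    using never signed_dist_P_single_infinity(1)[OF assms] by blast
qed

text \<open>At most one value enters per step, so a finite distance above 1 determines the value.
  What \<open>P i\<close> cannot split are its own two heaps and the values that no longer
  occur.\<close>

lemma signed_dist_P_single_eqD:
  assumes "i \<le> m" "v \<in> V" "w \<in> V" "signed_dist (P i) {#v#} = signed_dist (P i) {#w#}"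
  shows "v = w \<or> (v \<in> E i \<and> w \<in> E i) \<or> (\<forall>k. i \<le> k \<and> k \<le> m \<longrightarrow> v \<notin> E k \<and> w \<notin> E k)"
  using assms(1,2)
proof (cases rule: signed_dist_P_single_cases)
  case now
  from assms(1,3) show ?thesis
    by (cases rule: signed_dist_P_single_cases) (use now assms(4) in \<open>auto simp: one_ereal_def\<close>)
next
  case later
  from assms(1,3) show ?thesis
    by (cases rule: signed_dist_P_single_cases) (use later assms(4) in \<open>auto simp: one_ereal_def\<close>)
next
  case never
  from assms(1,3) show ?thesis
    by (cases rule: signed_dist_P_single_cases) (use never assms(4) in \<open>auto simp: one_ereal_def\<close>)
qed

lemma x_last_in_E: "0 < m \<Longrightarrow> x m \<in> E (m - 1)"
  using E_Suc[of "m - 1"] last by (auto simp: E_def)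

lemma E_last: "E m = {x m}"
  using last by (simp add: E_def)

lemma x_0_in_E_1: "0 < m \<Longrightarrow> x 0 \<in> E 1"
  using E_Suc[of 0] by simp

text \<open>Passing from \<open>P 0\<close> to \<open>P 1\<close> can lose only \<open>y 0\<close>.
  So for a landmark \<open>P i\<close> with \<open>i \<le> 1\<close> at most one single heap lies at
  distance infinity.\<close>

lemma not_later_than_1:
  assumes "i \<le> 1" "i \<le> m" "v \<in> V" "\<And>k. i \<le> k \<Longrightarrow> k \<le> m \<Longrightarrow> v \<notin> E k"
  shows "i = 1" "v = y 0"
proof -
  obtain k where k: "k \<le> m" "v \<in> E k"
    using assms(3) by (auto simp: V_def)
  then have "k < i"
    using assms(4)[of k] by force
  then show "i = 1"
    using assms(1) by simp
  have "v \<in> E 0"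
    using k \<open>k < i\<close> \<open>i = 1\<close> by simp
  then show "v = y 0"
    using x_0_in_E_1 assms(4)[of 1] assms(2) \<open>i = 1\<close> by (auto simp: E_def[of 0])
qed

section \<open>Explicit resolving sets\<close>

lemma resolving_Nil: "\<not> resolving []"
  using P_vert[of 0] empty_vert by (force simp: resolving_iff simp del: with_proj_simps)

text \<open>Seen from \<open>P m\<close>, the pairs have distinct distances at most 0, the heap
  \<open>x m\<close> has distance 1 and the empty position 2. With \<open>m \<le> 1\<close> there is
  at most one other single heap, at infinity.\<close>

lemma resolving_last_pair:
  assumes "m \<le> 1"
  shows "resolving [P m]"
  unfolding resolving_iff
proof (intro conjI ballI impI)
  fix p q
  assume p: "p \<in> verts G" and q: "q \<in> verts G"
    and "\<forall>u\<in>set [P m]. signed_dist u p = signed_dist u q"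
  then have eq: "signed_dist (P m) p = signed_dist (P m) q" by simp
  \<comment> \<open>A finite distance above 1 would require a value that enters after index
    \<open>m\<close>.\<close>
  have one_or_infinity: "signed_dist (P m) {#v#} \<in> {1, \<infinity>}" if "v \<in> V" for v
    using le_refl that by (cases rule: signed_dist_P_single_cases) auto
  have single_eq: "v = w"
    if "v \<in> V" "w \<in> V" "signed_dist (P m) {#v#} = signed_dist (P m) {#w#}" for v w
    using signed_dist_P_single_eqD[OF le_refl that] not_later_than_1(2)[of m v]
      not_later_than_1(2)[of m w] that assms E_last by auto
  show "p = q"
    using p
  proof (cases rule: vert_cases)
    case (P i)
    show ?thesis using q
      by (cases rule: vert_cases)
        (use P eq one_or_infinity in \<open>force simp: signed_dist_P_P signed_dist_P_empty one_ereal_def\<close>)+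
  next
    case (single v)
    then have v: "signed_dist (P m) p = 1 \<or> signed_dist (P m) p = \<infinity>"
      using one_or_infinity by blast
    show ?thesis using q
    proof (cases rule: vert_cases)
      case (P i)
      then show ?thesis
        using v eq by (auto simp: signed_dist_P_P one_ereal_def)
    next
      case (single w)
      then show ?thesis
        using single_eq[of v w] eq \<open>p = {#v#}\<close> \<open>v \<in> V\<close> by simp
    next
      case empty
      then show ?thesis
        using v eq by (auto simp: signed_dist_P_empty)
    qed
  next
    case empty
    show ?thesis using q
      by (cases rule: vert_cases)
        (use empty eq one_or_infinity in \<open>force simp: signed_dist_P_P signed_dist_P_empty one_ereal_def\<close>)+
  qed
qed (use P_vert in auto)

text \<open>The value \<open>x m\<close> occurs in the last pair, so every pair leads to
  \<open>{#x m#}\<close>. The negative sign is what lets this landmark recognise the pairs.\<close>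

lemma signed_dist_last_P:
  assumes "i \<le> m"
  obtains n where "signed_dist {#x m#} (P i) = ereal (- real (Suc n))"
proof -
  have "x m \<in> E m"
    using E_last by simp
  then obtain n where "i + n \<le> m" "x m \<in> E (i + n)" "\<And>l. l < n \<Longrightarrow> x m \<notin> E (i + l)"
    using first_occurrence[OF _ assms le_refl] by metis
  then show ?thesis
    using that signed_dist_P_single(2) by simp
qed

text \<open>The landmark \<open>{#x m#}\<close> reveals the kind of a vertex: negative for pairs, 0
  or infinity for single heaps, 1 for the empty position. \<open>P i\<close> then separates the
  pairs and most single heaps; of its own two heaps one is \<open>x m\<close>, which
  \<open>{#x m#}\<close> recognises.\<close>

lemma resolving_pair_single:
  assumes "i \<le> 1" "1 \<le> m" "x m \<in> E i"
  shows "resolving [P i, {#x m#}]"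
  unfolding resolving_iff
proof (intro conjI ballI impI)
  have i: "i \<le> m" and xV: "x m \<in> V"
    using assms E_last by (auto simp: V_def)
  show "distinct [P i, {#x m#}]" by simp
  show "set [P i, {#x m#}] \<subseteq> verts G"
    using P_vert[OF i] single_vert[OF xV] by auto
  fix p q
  assume p: "p \<in> verts G" and q: "q \<in> verts G"
    and "\<forall>u\<in>set [P i, {#x m#}]. signed_dist u p = signed_dist u q"
  then have eqP: "signed_dist (P i) p = signed_dist (P i) q"
    and eqx: "signed_dist {#x m#} p = signed_dist {#x m#} q" by simp_all
  have P_neg: "signed_dist {#x m#} (P k) < 0" if k: "k \<le> m" for k
    using signed_dist_last_P[OF k] by (metis ereal_less(2) less_ereal.simps(1) neg_less_0_iff_less
        of_nat_0_less_iff zero_ereal_def zero_less_Suc)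
  have single_eq: "v = w"
    if "v \<in> V" "w \<in> V" "signed_dist (P i) {#v#} = signed_dist (P i) {#w#}"
      "signed_dist {#x m#} {#v#} = signed_dist {#x m#} {#w#}" for v w
  proof -
    have x_iff: "v = x m \<longleftrightarrow> w = x m"
      using that(4) signed_dist_single_single[OF xV] that(1,2) by (auto split: if_splits)
    from signed_dist_P_single_eqD[OF i that(1-3)]
    consider "v = w" | "v \<in> E i" "w \<in> E i"
      | "\<And>k. i \<le> k \<Longrightarrow> k \<le> m \<Longrightarrow> v \<notin> E k" "\<And>k. i \<le> k \<Longrightarrow> k \<le> m \<Longrightarrow> w \<notin> E k"
      by blast
    then show ?thesis
    proof cases
      case 2
      then show ?thesis
        using x_iff assms(3) unfolding E_def by (metis insertE singletonD)
    next
      case 3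
      then show ?thesis
        using not_later_than_1(2)[OF assms(1) i that(1)] not_later_than_1(2)[OF assms(1) i that(2)]
        by simp
    qed
  qed
  show "p = q"
    using p
  proof (cases rule: vert_cases)
    case (P k)
    show ?thesis using q
    proof (cases rule: vert_cases)
      case (P l)
      then show ?thesis
        using eqP \<open>p = P k\<close> \<open>k \<le> m\<close> i by (simp add: signed_dist_P_P)
    qed (use P_neg[of k] P eqx in \<open>auto simp: signed_dist_single_single[OF xV]
          signed_dist_single_empty[OF xV] split: if_splits\<close>)
  next
    case (single v)
    show ?thesis using q
    proof (cases rule: vert_cases)
      case (P k)
      then show ?thesis
        using P_neg[of k] single eqx
        by (auto simp: signed_dist_single_single[OF xV] split: if_splits)
    next
      case (single w)
      then show ?thesis
        using single_eq[of v w] eqP eqx \<open>p = {#v#}\<close> \<open>v \<in> V\<close> by simp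
    next
      case empty
      then show ?thesis
        using single eqx
        by (auto simp: signed_dist_single_single[OF xV] signed_dist_single_empty[OF xV]
            split: if_splits)
    qed
  next
    case empty
    show ?thesis using q
      by (cases rule: vert_cases)
        (use P_neg empty eqx in \<open>fastforce simp: signed_dist_single_single[OF xV]
          signed_dist_single_empty[OF xV] split: if_splits\<close>)+
  qed
qed

text \<open>Seen from \<open>{#}\<close>, pairs are at -2, single heaps at -1 and the empty position
  at 0. \<open>P 0\<close> separates the pairs and, as every value occurs at some index from 0 on,
  all single heaps except possibly its own two, which \<open>{#y 0#}\<close> separates.\<close>

lemma resolving_triple: "resolving [P 0, {#}, {#y 0#}]"
  unfolding resolving_iff
proof (intro conjI ballI impI)
  have y_V: "y 0 \<in> V"
    by (auto simp: V_def E_def)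
  show "distinct [P 0, {#}, {#y 0#}]" by simp
  show "set [P 0, {#}, {#y 0#}] \<subseteq> verts G"
    using P_vert[of 0] single_vert[OF y_V] empty_vert by auto
  fix p q
  assume p: "p \<in> verts G" and q: "q \<in> verts G"
    and "\<forall>u\<in>set [P 0, {#}, {#y 0#}]. signed_dist u p = signed_dist u q"
  then have eqP: "signed_dist (P 0) p = signed_dist (P 0) q"
    and eq0: "signed_dist {#} p = signed_dist {#} q"
    and eqy: "signed_dist {#y 0#} p = signed_dist {#y 0#} q" by simp_all
  note sd = signed_dist_P_empty(2) signed_dist_single_empty(2) signed_dist_empty_empty
  show "p = q"
    using p
  proof (cases rule: vert_cases)
    case (P i)
    show ?thesis using q
      by (cases rule: vert_cases)
        (use P eqP eq0 in \<open>auto simp: sd signed_dist_P_P one_ereal_def\<close>)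
  next
    case (single v)
    show ?thesis using q
    proof (cases rule: vert_cases)
      case (single w)
      have "v = y 0 \<longleftrightarrow> w = y 0"
        using eqy single \<open>p = {#v#}\<close> \<open>v \<in> V\<close> signed_dist_single_single[OF y_V]
        by (auto split: if_splits)
      then have "v = w"
        using signed_dist_P_single_eqD[of 0 v w] eqP single \<open>p = {#v#}\<close> \<open>v \<in> V\<close>
        by (auto simp: V_def E_def[of 0])
      then show ?thesis
        using single \<open>p = {#v#}\<close> by simp
    qed (use single eq0 in \<open>auto simp: sd one_ereal_def\<close>)
  next
    case empty
    show ?thesis using q
      by (cases rule: vert_cases)
        (use empty eq0 in \<open>auto simp: sd one_ereal_def\<close>)
  qed
qed

section \<open>Lower bounds for resolving sets\<close>

text \<open>The value \<open>z\<close> enters one step before the end, so from \<open>P i\<close>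
  with \<open>i < m\<close> it takes \<open>m - 1 - i\<close> chain moves and one drop to reach
  \<open>{#z#}\<close>, exactly as many as the \<open>m - i\<close> moves to \<open>P m\<close>. A
  single heap other than \<open>z\<close> and \<open>x m\<close> has distance infinity to
  both.\<close>

lemma resolves_last_pair:
  assumes m: "2 \<le> m" and z: "z = y (m - 2) - x (m - 2)" and u: "u \<in> verts G"
    and "signed_dist u (P m) \<noteq> signed_dist u {#z#}"
  shows "u \<in> {{#}, P m, {#z#}, {#x m#}}"
  using u
proof (cases rule: vert_cases)
  case (P i)
  have "i = m"
  proof (rule ccontr)
    assume "i \<noteq> m"
    then have "i < m" using P by simp
    define r where "r = m - 2"
    have r: "m = Suc (Suc r)" using m by (simp add: r_def)
    have "z \<in> E (Suc r)" "\<And>j. j \<le> r \<Longrightarrow> z \<notin> E j"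
      using fresh_in_E[of r] fresh_notin_E[of _ r] z r by auto
    moreover have "Suc r = i + (Suc r - i)"
      using \<open>i < m\<close> r by simp
    ultimately have "signed_dist (P i) {#z#} = ereal (real (Suc (Suc r - i)))"
      using \<open>i < m\<close> r by (intro signed_dist_P_single) auto
    moreover have "Suc (Suc r - i) = m - i"
      using \<open>i < m\<close> r by simp
    ultimately show False
      using assms(4) \<open>i < m\<close> P signed_dist_P_P[of i m] by (simp add: of_nat_diff)
  qed
  then show ?thesis using P by simp
next
  case (single v)
  have "z \<in> V"
    using fresh_in_V[of "m - 2"] m z by simp
  have "v = z \<or> v = x m"
  proof (rule ccontr)
    assume "\<not> (v = z \<or> v = x m)"
    then have "signed_dist u (P m) = \<infinity>" "signed_dist u {#z#} = \<infinity>"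
      using single \<open>z \<in> V\<close> signed_dist_P_single_infinity(2)[of m v] E_last
      by (auto simp: signed_dist_single_single)
    then show False using assms(4) by simp
  qed
  then show ?thesis using single by auto
qed auto

lemma signed_dist_last_single:
  assumes "v \<in> V" "v \<noteq> x m"
  shows "signed_dist (P m) {#v#} = \<infinity>"
  using assms signed_dist_P_single_infinity(1)[of m v] E_last by auto

lemma y_V: "i \<le> m \<Longrightarrow> y i \<in> V"
  by (auto simp: V_def E_def)

text \<open>Each of the four candidates fails on its own: \<open>{#}\<close> on \<open>P 0\<close>
  and \<open>P 1\<close>, \<open>P m\<close> on the heaps \<open>y 0\<close> and \<open>y 1\<close>,
  which have disappeared by then, and a single heap on two of \<open>y 0\<close>,
  \<open>y 1\<close>, \<open>y 2\<close> that differ from it.\<close>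

lemma not_resolving_one:
  assumes m: "2 \<le> m"
  shows "\<not> resolving [u]"
proof
  assume res: "resolving [u]"
  then have u: "u \<in> verts G"
    by (simp add: resolving_iff)
  have inj: "p = q" if "p \<in> verts G" "q \<in> verts G" "signed_dist u p = signed_dist u q" for p q
    using res that by (auto simp: resolving_iff simp del: with_proj_simps)
  define z where "z = y (m - 2) - x (m - 2)"
  have z_V: "z \<in> V"
    using fresh_in_V[of "m - 2"] m z_def by simp
  have "signed_dist u (P m) \<noteq> signed_dist u {#z#}"
    using inj[OF P_vert single_vert, of m z] z_V by auto
  note last_pair = resolves_last_pair[OF m z_def u this]
  have y01: "y 0 \<in> V" "y 1 \<in> V" "y 2 \<in> V" "y 1 < y 0" "y 2 < y 1"
    using y_V y_less[of 0 1] y_less[of 1 2] m by auto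
  have "x m \<noteq> y 0" "x m \<noteq> y 1"
    using y_less[of 0 m] y_less[of 1 m] last m by auto
  have "x m \<in> V"
    using E_subset_V[of m] E_last by simp
  with last_pair consider "u = {#}" | "u = P m" | v where "v \<in> V" "u = {#v#}"
    using z_V by blast
  then show False
  proof cases
    case 1
    then show ?thesis
      using inj[OF P_vert P_vert, of 0 1] m P_eq_iff[of 0 1] by (simp add: signed_dist_P_empty)
  next
    case 2
    then show ?thesis
      using inj[OF single_vert single_vert, of "y 0" "y 1"] y01 \<open>x m \<noteq> y 0\<close> \<open>x m \<noteq> y 1\<close>
      by (simp add: signed_dist_last_single)
  next
    case 3
    then show ?thesis
      using y01 inj[OF single_vert single_vert, of "y 0" "y 1"]
        inj[OF single_vert single_vert, of "y 0" "y 2"]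
        inj[OF single_vert single_vert, of "y 1" "y 2"]
      by (cases "v = y 0"; cases "v = y 1") (auto simp: signed_dist_single_single)
  qed
qed

lemma resolving_length_ge_3:
  assumes m: "2 \<le> m" and x0: "x m \<notin> E 0" and x1: "x m \<notin> E 1"
    and res: "resolving us"
  shows "3 \<le> length us"
proof -
  \<comment> \<open>For \<open>m = 2\<close> the pair before the last is \<open>P 1\<close>, and
    that pair contains \<open>x m\<close>.\<close>
  have "m \<noteq> 2"
    using x_last_in_E x1 by auto
  then have m3: "3 \<le> m" using m by simp
  define z where "z = y (m - 2) - x (m - 2)"
  have z_nE: "z \<notin> E 0" "z \<notin> E 1"
    unfolding z_def using m3 by (intro fresh_notin_E; simp)+
  have z_V: "z \<in> V"
    using fresh_in_V[of "m - 2"] m z_def by simp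
  have inj: "p = q" if "p \<in> verts G" "q \<in> verts G"
    "\<And>u. u \<in> set us \<Longrightarrow> signed_dist u p = signed_dist u q" for p q
    using that res by (auto simp: resolving_iff simp del: with_proj_simps)
  obtain w where w: "w \<in> set us" "signed_dist w (P m) \<noteq> signed_dist w {#z#}"
    using inj[OF P_vert single_vert, of m z] z_V by auto
  have us: "set us \<subseteq> verts G" "distinct us"
    using res by (auto simp: resolving_iff)
  \<comment> \<open>These are the values of the first two pairs, all different from \<open>z\<close>
    and \<open>x m\<close>.\<close>
  let ?T = "{x 0, y 0, y 0 - x 0}"
  have T: "?T \<subseteq> E 0 \<union> E 1" "x 0 \<in> E 1" "y 0 - x 0 \<in> E 1"
    using E_Suc[of 0] m by (auto simp: E_def[of 0])
  have "E 0 \<union> E 1 \<subseteq> V"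
    using E_subset_V[of 0] E_subset_V[of 1] m by auto
  with T have T_V: "t \<in> V" if "t \<in> ?T" for t
    using that by blast
  have T_ne: "t \<noteq> z" "t \<noteq> x m" if "t \<in> ?T" for t
    using T(1) that x0 x1 z_nE by blast+
  have w_T: "signed_dist w {#t#} = signed_dist w {#t'#}" if "t \<in> ?T" "t' \<in> ?T" for t t'
  proof -
    have "w \<in> {{#}, P m, {#z#}, {#x m#}}"
      using resolves_last_pair[OF m z_def _ w(2)] w(1) us by blast
    moreover have "x m \<in> V"
      using E_subset_V[of m] E_last by simp
    ultimately show ?thesis
      using T_V[OF that(1)] T_V[OF that(2)] T_ne[OF that(1)] T_ne[OF that(2)] z_V
      by (auto simp: signed_dist_single_empty signed_dist_last_single signed_dist_single_single)
  qed
  \<comment> \<open>\<open>P 0\<close> contains \<open>x 0\<close> and \<open>y 0\<close>,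
    \<open>P 1\<close> contains \<open>x 0\<close> and \<open>y 0 - x 0\<close>, and from
    \<open>P 2\<close> on both \<open>y 0\<close> and \<open>y 1\<close> are gone. A single heap
    sees at least two of the three values at infinity, and \<open>{#}\<close> sees all of them at
    -1.\<close>
  have other: "\<exists>t\<in>?T. \<exists>t'\<in>?T. t \<noteq> t' \<and> signed_dist w' {#t#} = signed_dist w' {#t'#}"
    if "w' \<in> verts G" for w'
  proof -
    have ne: "x 0 \<noteq> y 0" "x 0 \<noteq> y 0 - x 0" "y 0 - x 0 \<noteq> y 0"
      using lt[of 0] pos[of 0] m fresh_notin_E[of 0 0] by (auto simp: E_def[of 0])
    note TV = T_V[of "x 0", simplified] T_V[of "y 0", simplified] T_V[of "y 0 - x 0", simplified]
    show ?thesis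
      using that
    proof (cases rule: vert_cases)
      case (P i)
      consider "i = 0" | "i = 1" | "2 \<le> i" by linarith
      then show ?thesis
      proof cases
        case 1
        then have "signed_dist w' {#x 0#} = signed_dist w' {#y 0#}"
          using P by (simp add: signed_dist_P_single_one E_def)
        then show ?thesis using ne by blast
      next
        case 2
        then have "signed_dist w' {#x 0#} = signed_dist w' {#y 0 - x 0#}"
          using P T by (simp add: signed_dist_P_single_one)
        then show ?thesis using ne by blast
      next
        case 3
        have y1: "y 1 \<in> {x 0, y 0 - x 0}"
          using E_Suc[of 0] m by (auto simp: E_def)
        have "signed_dist w' {#y j#} = \<infinity>" if "j < 2" for j
          using 3 P that y_V[of j] m y_notin_E[of j]
          by (auto intro!: signed_dist_P_single_infinity)
        then have "signed_dist w' {#y 1#} = signed_dist w' {#y 0#}"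
          by simp
        moreover have "y 1 \<noteq> y 0"
          using y1 ne by auto
        ultimately show ?thesis
          using y1 by (intro bexI[of _ "y 1"] bexI[of _ "y 0"]) auto
      qed
    next
      case (single v)
      then have "signed_dist w' {#t#} = \<infinity>" if "t \<in> ?T" "t \<noteq> v" for t
        using T_V[OF that(1)] that(2) by (simp add: signed_dist_single_single)
      then show ?thesis
        using ne by (cases "v = x 0"; cases "v = y 0") auto
    next
      case empty
      then show ?thesis
        using ne TV by (auto simp: signed_dist_single_empty)
    qed
  qed
  show ?thesis
  proof (rule ccontr)
    assume "\<not> 3 \<le> length us"
    then have "card (set us - {w}) \<le> 1"
      using w(1) distinct_card[OF us(2)] by simp
    then obtain w' where w': "set us - {w} \<subseteq> {w'}"
      by (metis List.finite_set card_le_Suc0_iff_eq One_nat_def finite_Diff singletonI subsetI)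
    \<comment> \<open>If \<open>w\<close> is the only landmark, \<open>w'\<close> may fail to be a
      vertex; then \<open>w\<close> itself serves as \<open>w''\<close>.\<close>
    have "\<exists>w''\<in>verts G. set us \<subseteq> {w, w''}"
      using w' w(1) us(1) by (cases "w' \<in> set us") blast+
    then obtain w'' where w'': "w'' \<in> verts G" "set us \<subseteq> {w, w''}" by blast
    then obtain t t' where t: "t \<in> ?T" "t' \<in> ?T" "t \<noteq> t'"
      "signed_dist w'' {#t#} = signed_dist w'' {#t'#}"
      using other by meson
    have "{#t#} = {#t'#}"
      using w''(2) w_T[OF t(1,2)] t(4) by (intro inj single_vert T_V t) auto
    then show False using t(3) by simp
  qed
qed

section \<open>The metric dimension in terms of the chain\<close>

lemma metric_dimension_eq:
  "metric_dimension = (if m \<le> 1 then 1 else if x m \<in> E 0 \<union> E 1 then 2 else 3)"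
proof -
  have one: "1 \<le> length us" if "resolving us" for us
    using that resolving_Nil by (cases us) auto
  have two: "2 \<le> length us" if "resolving us" "\<not> m \<le> 1" for us
    using that resolving_Nil not_resolving_one
    \<comment> \<open>This rule distinguishes lists with no entry, one entry and at least two
      entries.\<close>
    by (cases us rule: remdups_adj.cases) auto
  consider "m \<le> 1" | i where "\<not> m \<le> 1" "i \<le> 1" "x m \<in> E i"
    | "\<not> m \<le> 1" "x m \<notin> E 0" "x m \<notin> E 1"
    by (metis le_refl zero_le)
  then show ?thesis
  proof cases
    case 1
    then have "metric_dimension = enat 1"
      using one by (intro metric_dimension_eqI[OF resolving_last_pair]) auto
    then show ?thesis using 1 by (simp add: one_enat_def)
  next
    case 2
    then have "metric_dimension = enat 2"
      using two by (intro metric_dimension_eqI[OF resolving_pair_single[of i]]) auto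
    moreover have "x m \<in> E 0 \<union> E 1"
      using 2 by (cases i) auto
    ultimately show ?thesis using 2 by (simp add: numeral_eq_enat)
  next
    case 3
    then have "metric_dimension = enat 3"
      using resolving_length_ge_3 by (intro metric_dimension_eqI[OF resolving_triple]) auto
    then show ?thesis using 3 by (simp add: numeral_eq_enat)
  qed
qed

text \<open>Subtracting the smaller heap from the larger preserves the gcd of the pair, and the last
  pair has \<open>x m\<close> as its only value.\<close>

lemma x_last_eq_gcd: "x m = gcd (x 0) (y 0)"
proof -
  have "i \<le> m \<Longrightarrow> Gcd (E i) = Gcd (E 0)" for i
  proof (induction i)
    case (Suc i)
    then have "Gcd (E (Suc i)) = gcd (x i) (y i - x i)"
      using E_Suc[of i] by simp
    also have "\<dots> = Gcd (E i)"
      using lt[of i] Suc.prems gcd_diff1_nat[of "x i" "y i"] by (simp add: E_def gcd.commute)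
    finally show ?case using Suc by simp
  qed simp
  from this[of m] show ?thesis
    by (simp add: E_last) (simp add: E_def)
qed

end

section \<open>Existence of the chain and translation to the heaps \<open>a\<close> and
  \<open>b\<close>\<close>

lemma subtractive_chain_exists:
  "0 < a \<Longrightarrow> a \<le> b \<Longrightarrow> \<exists>x y m. subtractive_chain x y m \<and> x 0 = a \<and> y 0 = b"
proof (induction b arbitrary: a rule: less_induct)
  case (less b)
  show ?case
  proof (cases "a = b")
    case True
    then have "subtractive_chain (\<lambda>_. a) (\<lambda>_. b) 0"
      using less.prems by unfold_locales auto
    then show ?thesis by auto
  next
    case False
    let ?a = "min a (b - a)" and ?b = "max a (b - a)"
    have "?b < b" "0 < ?a" "?a \<le> ?b"
      using False less.prems by auto
    then obtain x y m where "subtractive_chain x y m" and 0: "x 0 = ?a" "y 0 = ?b"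
      using less.IH by blast
    then interpret subtractive_chain x y m by simp
    \<comment> \<open>\<open>case_nat\<close> puts the pair \<open>a\<close>, \<open>b\<close> in
      front of the chain and shifts the old indices by one.\<close>
    have "subtractive_chain (case_nat a x) (case_nat b y) (Suc m)"
      using False less.prems pos lt last step 0
      by unfold_locales (auto split: nat.splits simp: min_def max_def add_mset_commute)
    then show ?thesis
      by (metis old.nat.simps(4))
  qed
qed

text \<open>Scaling both heaps by a common factor gives an isomorphic game graph, so the cases
  concern the heaps divided by their gcd: the heaps 2 and 4 behave like 1 and 2.\<close>

theorem theorem4p2:
  fixes a b :: nat
  assumes "0 < a" and "a \<le> b"
  shows "let a' = a div gcd a b; b' = b div gcd a b in
    wf_digraph.metric_dimension (with_proj (hats_nim_graph {#a, b#})) =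
      (if a = b \<or> {#a', b'#} = {#1, 2#} then 1
       else if (2 < b' \<and> b' = a' + 1) \<or> (a' = 1 \<and> b' > 2) then 2
       else 3)"
proof -
  obtain x y m where "subtractive_chain x y m" and xy: "x 0 = a" "y 0 = b"
    using subtractive_chain_exists assms by blast
  then interpret subtractive_chain x y m by simp
  define g a' b' where "g = gcd a b" and "a' = a div g" and "b' = b div g"
  have g: "0 < g" "x m = g"
    using assms x_last_eq_gcd xy by (auto simp: g_def)
  have ab: "a = g * a'" "b = g * b'"
    by (simp_all add: g_def a'_def b'_def)
  have a': "0 < a'" "a' \<le> b'"
    using assms g ab by auto
  have m0: "m = 0 \<longleftrightarrow> a' = b'"
    using lt[of 0] last xy g ab by (cases m) auto
  have E0: "E 0 = {g * a', g * b'}"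
    using xy ab by (simp add: E_def)
  have E1: "E 1 = {g * a', g * (b' - a')}" if "m \<noteq> 0"
    using that E_Suc[of 0] xy ab by (simp add: diff_mult_distrib2)
  \<comment> \<open>For \<open>m > 1\<close> the pair \<open>P 1\<close> still has two different
    heaps, by \<open>lt\<close>.\<close>
  have "m = 1 \<longleftrightarrow> m \<noteq> 0 \<and> card (E 1) = 1"
    using E_last lt[of 1] by (cases "m \<le> 1") (auto simp: E_def le_Suc_eq)
  then have m1: "m = 1 \<longleftrightarrow> a' \<noteq> b' \<and> b' = 2 * a'"
    using E1 m0 g a' by (cases "m = 0") (auto simp: card_insert_if)
  have "coprime a' b'"
    using assms div_gcd_coprime[of a b] by (simp add: a'_def b'_def g_def)
  \<comment> \<open>If \<open>b' = 2 * a'\<close>, then \<open>a'\<close> divides both numbers, so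
    coprimality forces \<open>a' = 1\<close>.\<close>
  then have "b' = 2 * a' \<longleftrightarrow> a' = 1 \<and> b' = 2"
    by auto
  then have le1: "m \<le> 1 \<longleftrightarrow> a = b \<or> {#a', b'#} = {#1, 2#}"
    using m0 m1 ab g a' by (auto simp: le_Suc_eq add_eq_conv_ex)
  \<comment> \<open>Divided by \<open>g\<close>, membership says that 1 is among \<open>a'\<close>,
    \<open>b'\<close> and \<open>b' - a'\<close>; since \<open>m > 1\<close> excludes
    \<open>a' = b'\<close> and \<open>b' = 2 * a'\<close>, exactly the listed cases remain.\<close>
  have "x m \<in> E 0 \<union> E 1 \<longleftrightarrow> (2 < b' \<and> b' = a' + 1) \<or> (a' = 1 \<and> b' > 2)" if "\<not> m \<le> 1"
    using that m0 m1 a' g E0 E1 by auto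
  then show ?thesis
    using metric_dimension_eq le1 xy unfolding g_def[symmetric] a'_def[symmetric] b'_def[symmetric] Let_def
    by simp
qed

end
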